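(* Let $(\beta_i)_{i=0}^{\infty}$ be a sequence of positive real numbers such that (1) $\sum_{i=0}^{\infty}\beta_i<1$; (2) $\sqrt{n}\sum_{i=n}^{\infty}\beta_i\to 0$ as $n\to\infty$; (3) $\frac{1}{\sqrt{n}}\sum_{i=1}^{n} i\beta_i\to 0$ as $n\to\infty$; (4) $\sum_{i=1}^{\infty} i\beta_i<\infty$. Let $\{H_n\}_{n\ge 1}$ be the discrete-time Hawkes process with parameters $(\beta_i)_{i\ge 0}$. Then $$\frac{H_n}{n}\to\frac{\beta_0}{1-\sum_{i=1}^{\infty}\beta_i}\quad\text{almost surely as } n\to\infty.$$
   Context: Discrete-time Hawkes process (DTHP): on a probability space $(\Omega,\mathcal{F},\mathbb{P})$, let $(\xi_n)_{n\ge 1}$ be $\{0,1\}$-valued random variables with $\mathbb{P}(\xi_1=1)=\beta_0$ and, for $n\ge 2$, $\mathbb{P}(\xi_n=1\mid \xi_1,\ldots,\xi_{n-1})=\beta_0+\sum_{i=1}^{n-1}\beta_{n-i}\xi_i$ (and $\xi_n=0$ with the complementary conditional probability). The DTHP is $H_n=\sum_{i=1}^n\xi_i$, $n\ge 1$. *)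

theory Defs
  imports "HOL-Probability.Probability"
begin

definition past_sigma :: "'a measure \<Rightarrow> (nat \<Rightarrow> 'a \<Rightarrow> real) \<Rightarrow> nat \<Rightarrow> 'a measure" where
  "past_sigma M \<xi> n =
     sigma (space M) {\<xi> i -` B \<inter> space M | i B. i \<in> {1..<n} \<and> B \<in> sets borel}"

text \<open>
  Times run over \<open>n \<ge> 1\<close>; \<open>\<xi> 0\<close> is unconstrained and never used. The conditional
  probability given \<open>\<xi> 1, \<dots>, \<xi> (n - 1)\<close> is the conditional expectation of the indicator
  of \<open>{\<xi> n = 1}\<close> with respect to the sigma-algebra generated by these variables, so the
  defining identity holds only almost everywhere. The complementary probability of
  \<open>{\<xi> n = 0}\<close> follows, because \<open>\<xi> n\<close> takes values in \<open>{0, 1}\<close>.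
\<close>

locale discrete_hawkes = prob_space M
  for M :: "'a measure" and \<beta> :: "nat \<Rightarrow> real" and \<xi> :: "nat \<Rightarrow> 'a \<Rightarrow> real" +
  assumes rv: "\<And>n. 1 \<le> n \<Longrightarrow> random_variable borel (\<xi> n)"
    and values_01: "\<And>n \<omega>. 1 \<le> n \<Longrightarrow> \<omega> \<in> space M \<Longrightarrow> \<xi> n \<omega> \<in> {0, 1}"
    and init: "\<P>(\<omega> in M. \<xi> 1 \<omega> = 1) = \<beta> 0"
    and step: "\<And>n. 2 \<le> n \<Longrightarrow>
      AE \<omega> in M. real_cond_exp M (past_sigma M \<xi> n) (indicator {\<omega> \<in> space M. \<xi> n \<omega> = 1}) \<omega>
                 = \<beta> 0 + (\<Sum>i = 1..n - 1. \<beta> (n - i) * \<xi> i \<omega>)"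

text \<open>
  The library's conditional expectation is the intended one only for genuine subalgebras
  (it is identically 0 otherwise).
\<close>

lemma (in discrete_hawkes) subalgebra_past_sigma: "subalgebra M (past_sigma M \<xi> n)"
proof -
  have "{\<xi> i -` B \<inter> space M | i B. i \<in> {1..<n} \<and> B \<in> sets borel} \<subseteq> sets M"
    using rv by (auto intro: measurable_sets)
  then show ?thesis
    unfolding subalgebra_def past_sigma_def
    by (auto simp: space_measure_of_conv sets_measure_of_conv
             intro: sets.sigma_sets_subset[THEN subsetD] split: if_splits)
qed

definition hawkes_count :: "(nat \<Rightarrow> 'a \<Rightarrow> real) \<Rightarrow> nat \<Rightarrow> 'a \<Rightarrow> real" where
  "hawkes_count \<xi> n \<omega> = (\<Sum>i = 1..n. \<xi> i \<omega>)"

end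

(* Proof idea. The differences between xi_n and its conditional probability lambda_n are bounded
   and orthogonal to their past, so their partial sums S_n have second moment at most n; hence
   S_n / n tends to 0 almost surely, first along the squares and then everywhere. Exchanging the
   order of summation in the sum of the lambda_m gives, with b = beta_1 + beta_2 + ...,
   (1 - b) H_n = n beta_0 + S_n - R_n, where R_n is at most the sum of the first n tails of the
   series b, which is o(n) by Cesaro averaging. *)

theory Submission
  imports Defs "HOL-Library.Discrete_Functions"
begin

lemma cesaro_null:
  fixes u :: "nat \<Rightarrow> real"
  assumes "u \<longlonglongrightarrow> 0"
  shows "(\<lambda>n. (\<Sum>k<n. u k) / real n) \<longlonglongrightarrow> 0"
proof (rule LIMSEQ_I)
  fix e :: real assume e: "0 < e"
  obtain N where N: "\<And>k. k \<ge> N \<Longrightarrow> \<bar>u k\<bar> < e / 2"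
    using LIMSEQ_D[OF assms, of "e / 2"] e by auto
  define A where "A = (\<Sum>k<N. \<bar>u k\<bar>)"
  have A0: "0 \<le> A" by (simp add: A_def sum_nonneg)
  \<comment> \<open>Each term from \<open>N\<close> on costs at most \<open>e / 2\<close>. The fixed
    head \<open>A\<close> falls below the other half, \<open>e / 2 * n\<close>, once
    \<open>n\<close> exceeds \<open>2 * A / e\<close>.\<close>
  obtain m :: nat where m: "2 * A / e < real m" using reals_Archimedean2 by blast
  have "\<bar>(\<Sum>k<n. u k) / real n\<bar> < e" if n: "n \<ge> max 1 (max N m)" for n
  proof -
    have "\<bar>\<Sum>k<n. u k\<bar> \<le> (\<Sum>k<n. \<bar>u k\<bar>)" by (rule sum_abs)
    also have "\<dots> = A + (\<Sum>k=N..<n. \<bar>u k\<bar>)"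
      using n by (simp add: A_def lessThan_atLeast0 sum.atLeastLessThan_concat)
    also have "(\<Sum>k=N..<n. \<bar>u k\<bar>) \<le> (\<Sum>k=N..<n. e / 2)"
      using N by (intro sum_mono) (auto intro: less_imp_le)
    also have "\<dots> \<le> real n * (e / 2)"
      using e by (auto simp: intro!: mult_right_mono)
    also have "A < e / 2 * real n"
    proof -
      have "2 * A / e < real n" using m n by linarith
      then show ?thesis using e by (simp add: field_simps)
    qed
    finally have "\<bar>\<Sum>k<n. u k\<bar> < e * real n" by (simp add: algebra_simps)
    then show ?thesis using n by (simp add: abs_divide field_simps)
  qed
  then show "\<exists>no. \<forall>n\<ge>no. norm ((\<Sum>k<n. u k) / real n - 0) < e"
    unfolding real_norm_def diff_0_right by blast
qed

text \<open>With q the integer square root of n, at most 2q indices separate q^2 from n, since n <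
  (q + 1)^2. Terms bounded by 1 therefore move the sum by at most 2q, which is negligible against n
  \<ge> q^2.\<close>

lemma averages_null_if_squares_null:
  fixes d :: "nat \<Rightarrow> real"
  assumes bounded: "\<And>i. \<bar>d i\<bar> \<le> 1"
    and squares: "(\<lambda>k. (\<Sum>i<k\<^sup>2. d i) / real (k\<^sup>2)) \<longlonglongrightarrow> 0"
  shows "(\<lambda>n. (\<Sum>i<n. d i) / real n) \<longlonglongrightarrow> 0"
proof -
  \<comment> \<open>\<open>g k\<close> dominates every average whose length has integer square root
    \<open>k\<close>: the value at the square, plus the gap \<open>2 * k\<close> divided by
    \<open>k\<^sup>2\<close>.\<close>
  define g where "g k = \<bar>(\<Sum>i<k\<^sup>2. d i) / real (k\<^sup>2)\<bar> + 2 / real k" for k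
  have "g \<longlonglongrightarrow> 0"
    unfolding g_def using tendsto_add[OF tendsto_rabs_zero[OF squares] lim_const_over_n[of 2]] by simp
  moreover have "filterlim floor_sqrt at_top sequentially"
    unfolding filterlim_at_top eventually_sequentially by (metis le_floor_sqrt_iff)
  ultimately have lim: "(\<lambda>n. g (floor_sqrt n)) \<longlonglongrightarrow> 0"
    by (rule filterlim_compose)
  have bound: "\<bar>(\<Sum>i<n. d i) / real n\<bar> \<le> g (floor_sqrt n)" if n: "n \<ge> 1" for n
  proof -
    define q where "q = floor_sqrt n"
    have q: "q > 0" "q\<^sup>2 \<le> n" using n by (auto simp: q_def)
    have "n < (Suc q)\<^sup>2" unfolding q_def by (rule Suc_floor_sqrt_power2_gt)
    then have gap: "n - q\<^sup>2 \<le> 2 * q" by (simp add: power2_eq_square)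
    have "(\<Sum>i<n. d i) = (\<Sum>i<q\<^sup>2. d i) + (\<Sum>i=q\<^sup>2..<n. d i)"
      using q by (simp add: lessThan_atLeast0 sum.atLeastLessThan_concat)
    moreover have "\<bar>\<Sum>i=q\<^sup>2..<n. d i\<bar> \<le> real (n - q\<^sup>2)"
      using sum_norm_bound[of "{q\<^sup>2..<n}" d 1] bounded by simp
    moreover have "real (n - q\<^sup>2) \<le> 2 * real q" using gap by linarith
    ultimately have "\<bar>\<Sum>i<n. d i\<bar> \<le> \<bar>\<Sum>i<q\<^sup>2. d i\<bar> + 2 * real q" by linarith
    then have "\<bar>\<Sum>i<n. d i\<bar> / real n \<le> (\<bar>\<Sum>i<q\<^sup>2. d i\<bar> + 2 * real q) / real (q\<^sup>2)"
      using q n by (intro frac_le) auto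
    also have "\<dots> = g q"
      using q by (simp add: g_def add_divide_distrib abs_divide power2_eq_square)
    finally show ?thesis by (simp add: q_def abs_divide)
  qed
  show ?thesis
    using lim by (rule Lim_null_comparison[rotated])
      (use bound in \<open>auto simp: eventually_sequentially intro!: exI[of _ 1]\<close>)
qed

text \<open>Adding \<open>d n\<close> to the partial sum changes the square by a cross term of mean
  0 and by a square that is at most 1, so the second moment grows by at most 1 per step. The cross
  term involves only the product of \<open>d n\<close> with the whole partial sum, hence the form of
  \<open>orthogonal\<close>.\<close>

lemma (in prob_space) second_moment_orthogonal_sum:
  fixes d :: "nat \<Rightarrow> 'a \<Rightarrow> real"
  assumes rv [measurable]: "\<And>i. random_variable borel (d i)"
    and bounded: "\<And>i \<omega>. \<omega> \<in> space M \<Longrightarrow> \<bar>d i \<omega>\<bar> \<le> 1"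
    and orthogonal: "\<And>n. expectation (\<lambda>\<omega>. (\<Sum>i<n. d i \<omega>) * d n \<omega>) = 0"
  shows "integrable M (\<lambda>\<omega>. (\<Sum>i<n. d i \<omega>)\<^sup>2)"
    and "expectation (\<lambda>\<omega>. (\<Sum>i<n. d i \<omega>)\<^sup>2) \<le> real n"
proof -
  have S_bound: "\<bar>\<Sum>i<n. d i \<omega>\<bar> \<le> real n" if "\<omega> \<in> space M" for n \<omega>
    using sum_norm_bound[of "{..<n}" "\<lambda>i. d i \<omega>" 1] bounded[OF that] by simp
  have int_sq: "integrable M (\<lambda>\<omega>. (\<Sum>i<n. d i \<omega>)\<^sup>2)" for n
    by (rule integrable_const_bound[of _ "(real n)\<^sup>2"])
      (use S_bound in \<open>auto simp: abs_le_square_iff[symmetric]\<close>)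
  then show "integrable M (\<lambda>\<omega>. (\<Sum>i<n. d i \<omega>)\<^sup>2)" .
  have sq: "(d n \<omega>)\<^sup>2 \<le> 1" if "\<omega> \<in> space M" for n \<omega>
    using bounded[OF that] by (simp add: abs_square_le_1)
  have int_d: "integrable M (\<lambda>\<omega>. (d n \<omega>)\<^sup>2)" for n
    by (rule integrable_const_bound[of _ 1]) (use sq in auto)
  have int_cross: "integrable M (\<lambda>\<omega>. (\<Sum>i<n. d i \<omega>) * d n \<omega>)" for n
  proof (rule integrable_const_bound[of _ "real n"])
    show "AE \<omega> in M. norm ((\<Sum>i<n. d i \<omega>) * d n \<omega>) \<le> real n"
    proof (rule AE_I2)
      fix \<omega> assume w: "\<omega> \<in> space M"
      show "norm ((\<Sum>i<n. d i \<omega>) * d n \<omega>) \<le> real n"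
        using mult_mono[OF S_bound[OF w] bounded[OF w]] by (simp add: abs_mult)
    qed
  qed measurable
  show "expectation (\<lambda>\<omega>. (\<Sum>i<n. d i \<omega>)\<^sup>2) \<le> real n"
  proof (induction n)
    case (Suc n)
    have "expectation (\<lambda>\<omega>. (\<Sum>i<Suc n. d i \<omega>)\<^sup>2) =
        expectation (\<lambda>\<omega>. (\<Sum>i<n. d i \<omega>)\<^sup>2 + 2 * ((\<Sum>i<n. d i \<omega>) * d n \<omega>) + (d n \<omega>)\<^sup>2)"
      by (simp add: power2_sum algebra_simps)
    also have "\<dots> = expectation (\<lambda>\<omega>. (\<Sum>i<n. d i \<omega>)\<^sup>2) + expectation (\<lambda>\<omega>. (d n \<omega>)\<^sup>2)"
      using int_sq int_d int_cross orthogonal[of n] by simp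
    also have "expectation (\<lambda>\<omega>. (d n \<omega>)\<^sup>2) \<le> 1"
      by (rule integral_le_const[OF int_d]) (use sq in auto)
    finally show ?case using Suc by simp
  qed simp
qed

text \<open>The squared average of n terms has mean at most 1 / n, which is not summable, but along
  n = k^2 the bound 1 / k^2 is. The sum of these squared averages then has finite integral, hence is
  finite almost everywhere, and so its terms tend to 0.\<close>

lemma (in prob_space) strong_law_bounded_orthogonal:
  fixes d :: "nat \<Rightarrow> 'a \<Rightarrow> real"
  assumes rv [measurable]: "\<And>i. random_variable borel (d i)"
    and bounded: "\<And>i \<omega>. \<omega> \<in> space M \<Longrightarrow> \<bar>d i \<omega>\<bar> \<le> 1"
    and orthogonal: "\<And>n. expectation (\<lambda>\<omega>. (\<Sum>i<n. d i \<omega>) * d n \<omega>) = 0"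
  shows "AE \<omega> in M. (\<lambda>n. (\<Sum>i<n. d i \<omega>) / real n) \<longlonglongrightarrow> 0"
proof -
  define Y where "Y k \<omega> = ((\<Sum>i<k\<^sup>2. d i \<omega>) / real (k\<^sup>2))\<^sup>2" for k \<omega>
  have [measurable]: "Y k \<in> borel_measurable M" for k unfolding Y_def by measurable
  have Y0: "0 \<le> Y k \<omega>" for k \<omega> by (simp add: Y_def)
  have EY: "(\<integral>\<^sup>+\<omega>. ennreal (Y k \<omega>) \<partial>M) \<le> ennreal (1 / (real k)\<^sup>2)" for k
  proof -
    have "integrable M (Y k)"
      unfolding Y_def power_divide
      by (intro integrable_divide second_moment_orthogonal_sum assms)
    then have "(\<integral>\<^sup>+\<omega>. ennreal (Y k \<omega>) \<partial>M) = ennreal (expectation (Y k))"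
      by (intro nn_integral_eq_integral) (auto simp: Y0)
    also have "expectation (Y k) = expectation (\<lambda>\<omega>. (\<Sum>i<k\<^sup>2. d i \<omega>)\<^sup>2) / (real (k\<^sup>2))\<^sup>2"
      unfolding Y_def power_divide by simp
    also have "\<dots> \<le> real (k\<^sup>2) / (real (k\<^sup>2))\<^sup>2"
      by (intro divide_right_mono second_moment_orthogonal_sum assms) auto
    \<comment> \<open>For \<open>k = 0\<close> both sides are 0, as division by 0 yields 0, so the
      series can start there.\<close>
    also have "\<dots> = 1 / (real k)\<^sup>2" by (cases "k = 0") (simp_all add: power2_eq_square)
    finally show ?thesis by (simp add: ennreal_leI)
  qed
  have "(\<integral>\<^sup>+\<omega>. (\<Sum>k. ennreal (Y k \<omega>)) \<partial>M) = (\<Sum>k. \<integral>\<^sup>+\<omega>. ennreal (Y k \<omega>) \<partial>M)"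
    by (rule nn_integral_suminf) measurable
  also have "\<dots> \<le> (\<Sum>k. ennreal (1 / (real k)\<^sup>2))"
    by (intro suminf_le EY) auto
  also have "\<dots> = ennreal (\<Sum>k. 1 / (real k)\<^sup>2)"
    by (intro suminf_ennreal2)
      (use inverse_power_summable[of 2, where 'a = real] in \<open>auto simp: inverse_eq_divide\<close>)
  finally have "(\<integral>\<^sup>+\<omega>. (\<Sum>k. ennreal (Y k \<omega>)) \<partial>M) \<noteq> \<infinity>" by (auto simp: top_unique)
  then have "AE \<omega> in M. (\<Sum>k. ennreal (Y k \<omega>)) \<noteq> \<infinity>"
    by (intro nn_integral_PInf_AE) measurable
  then show ?thesis
    using AE_space
  proof eventually_elim
    case (elim \<omega>)
    then have "summable (\<lambda>k. Y k \<omega>)"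
      using Y0 by (intro summable_suminf_not_top) (auto simp: infinity_ennreal_def)
    then have "(\<lambda>k. sqrt (Y k \<omega>)) \<longlonglongrightarrow> 0"
      using tendsto_real_sqrt[OF summable_LIMSEQ_zero] by fastforce
    then have "(\<lambda>k. (\<Sum>i<k\<^sup>2. d i \<omega>) / real (k\<^sup>2)) \<longlonglongrightarrow> 0"
      unfolding Y_def real_sqrt_abs by (simp only: tendsto_rabs_zero_iff)
    then show ?case
      using bounded elim by (intro averages_null_if_squares_null)
  qed
qed

text \<open>This is the pathwise half of the argument, free of probability. The value
  \<open>x i\<close> spreads total weight b = \<beta> 1 + \<beta> 2 + ... over later times, and only
  the part landing at time \<open>n\<close> or later is missing from the first \<open>n\<close>
  compensators. That missing part is negligible on average, and b < 1 allows solving for the average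
  of \<open>x\<close>.\<close>

lemma average_limit_of_compensated:
  fixes \<beta> x :: "nat \<Rightarrow> real"
  assumes pos: "\<And>i. 0 \<le> \<beta> i" and summable_beta: "summable \<beta>"
    and lt_1: "(\<Sum>i. \<beta> (Suc i)) < 1"
    and x: "\<And>i. 0 \<le> x i" "\<And>i. x i \<le> 1"
    and lim: "(\<lambda>n. (\<Sum>m<n. x m - (\<beta> 0 + (\<Sum>i<m. \<beta> (m - i) * x i))) / real n) \<longlonglongrightarrow> 0"
  shows "(\<lambda>n. (\<Sum>i<n. x i) / real n) \<longlonglongrightarrow> \<beta> 0 / (1 - (\<Sum>i. \<beta> (Suc i)))"
proof -
  \<comment> \<open>\<open>T k\<close> starts at \<open>\<beta> (Suc k)\<close>, so
    \<open>T 0\<close> is b. In \<open>R n\<close>, the factor \<open>T (n - Suc i)\<close> is the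
    weight that \<open>x i\<close> places on times from \<open>n\<close> on.\<close>
  define T where "T k = (\<Sum>i. \<beta> (i + Suc k))" for k
  define R where "R n = (\<Sum>i<n. x i * T (n - Suc i))" for n
  define S where "S n = (\<Sum>m<n. x m - (\<beta> 0 + (\<Sum>i<m. \<beta> (m - i) * x i)))" for n
  have sm: "summable (\<lambda>i. \<beta> (i + k))" for k
    using summable_beta by (simp add: summable_iff_shift)
  have T0: "0 \<le> T k" for k unfolding T_def by (intro suminf_nonneg sm pos)
  have T_Suc: "T k = \<beta> (Suc k) + T (Suc k)" for k
    using suminf_split_head[OF sm[of "Suc k"]] by (simp add: T_def)
  have T_lim: "T \<longlonglongrightarrow> 0"
    using suminf_exist_split2[OF summable_beta] unfolding T_def by (rule LIMSEQ_Suc)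
  \<comment> \<open>Induction replaces the exchange of a double sum: passing from \<open>n\<close>
    to \<open>Suc n\<close>, the new term adds \<open>x n * T 0\<close> to \<open>R\<close>, while
    each earlier tail loses its first entry \<open>\<beta> (n - i)\<close>.\<close>
  have S_eq: "S n = (1 - T 0) * (\<Sum>i<n. x i) - real n * \<beta> 0 + R n" for n
  proof (induction n)
    case (Suc n)
    have "R (Suc n) = x n * T 0 + (\<Sum>i<n. x i * T (n - i))" by (simp add: R_def)
    also have "(\<Sum>i<n. x i * T (n - i)) = (\<Sum>i<n. x i * T (n - Suc i) - \<beta> (n - i) * x i)"
    proof (rule sum.cong)
      fix i assume "i \<in> {..<n}"
      then show "x i * T (n - i) = x i * T (n - Suc i) - \<beta> (n - i) * x i"
        using T_Suc[of "n - Suc i"] by (simp add: Suc_diff_Suc algebra_simps)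
    qed simp
    finally have "R (Suc n) = x n * T 0 + R n - (\<Sum>i<n. \<beta> (n - i) * x i)"
      by (simp add: R_def sum_subtractf)
    moreover have "S (Suc n) = S n + (x n - (\<beta> 0 + (\<Sum>i<n. \<beta> (n - i) * x i)))"
      by (simp add: S_def)
    ultimately show ?case using Suc by (simp add: algebra_simps)
  qed (simp add: S_def R_def)
  \<comment> \<open>Replacing each \<open>x i\<close> by 1 and reversing the order leaves the first
    \<open>n\<close> tails, whose average vanishes because \<open>T\<close> tends to 0.\<close>
  have R_bound: "\<bar>R n\<bar> \<le> (\<Sum>k<n. T k)" for n
  proof -
    have "R n \<le> (\<Sum>i<n. T (n - Suc i))"
      unfolding R_def by (intro sum_mono) (use x T0 in \<open>auto intro: mult_left_le_one_le\<close>)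
    moreover have "0 \<le> R n" unfolding R_def by (intro sum_nonneg) (use x T0 in auto)
    ultimately show ?thesis by (simp add: sum.nat_diff_reindex)
  qed
  have R_lim: "(\<lambda>n. R n / real n) \<longlonglongrightarrow> 0"
    by (rule Lim_null_comparison[OF _ cesaro_null[OF T_lim]])
      (auto simp: R_bound abs_divide intro!: always_eventually divide_right_mono)
  have b: "T 0 = (\<Sum>i. \<beta> (Suc i))" by (simp add: T_def)
  have "(\<lambda>n. (S n / real n - R n / real n + \<beta> 0) / (1 - T 0)) \<longlonglongrightarrow> (0 - 0 + \<beta> 0) / (1 - T 0)"
    using lim R_lim lt_1 unfolding b S_def by (intro tendsto_intros) auto
  moreover have "(\<Sum>i<n. x i) / real n = (S n / real n - R n / real n + \<beta> 0) / (1 - T 0)"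
    if "n \<ge> 1" for n
  proof -
    have "S n / real n - R n / real n + \<beta> 0 = (1 - T 0) * ((\<Sum>i<n. x i) / real n)"
      using that unfolding S_eq by (simp add: diff_divide_distrib add_divide_distrib)
    then show ?thesis using lt_1 unfolding b by simp
  qed
  ultimately show ?thesis
    unfolding b
    by (auto simp: eventually_sequentially intro!: exI[of _ 1] elim!: Lim_transform_eventually)
qed

theorem theorem4p1:
  fixes M :: "'a measure" and \<beta> :: "nat \<Rightarrow> real" and \<xi> :: "nat \<Rightarrow> 'a \<Rightarrow> real"
  assumes pos: "\<And>i. 0 < \<beta> i"
    and summable_beta: "summable \<beta>" and sum_lt_1: "(\<Sum>i. \<beta> i) < 1"
    and tail: "(\<lambda>n. sqrt (real n) * (\<Sum>i. \<beta> (n + i))) \<longlonglongrightarrow> 0"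
    and weighted: "(\<lambda>n. 1 / sqrt (real n) * (\<Sum>i = 1..n. real i * \<beta> i)) \<longlonglongrightarrow> 0"
    and summable_weighted: "summable (\<lambda>i. real (Suc i) * \<beta> (Suc i))"
    and hawkes: "discrete_hawkes M \<beta> \<xi>"
  shows "AE \<omega> in M. (\<lambda>n. hawkes_count \<xi> n \<omega> / real n)
           \<longlonglongrightarrow> \<beta> 0 / (1 - (\<Sum>i. \<beta> (Suc i)))"
proof -
  interpret discrete_hawkes M \<beta> \<xi> by (rule hawkes)
  \<comment> \<open>Times are shifted to start at 0. Differences of times are unaffected, so
    \<open>l n\<close> is the conditional probability of \<open>x n = 1\<close> given the earlier
    values, with the empty sum giving \<open>l 0 = \<beta> 0\<close>.\<close>
  define x where "x i = \<xi> (Suc i)" for i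
  define l where "l n \<omega> = \<beta> 0 + (\<Sum>i<n. \<beta> (n - i) * x i \<omega>)" for n \<omega>
  have [measurable]: "x i \<in> borel_measurable M" for i unfolding x_def by (rule rv) simp
  have [measurable]: "l n \<in> borel_measurable M" for n unfolding l_def by measurable
  have x01: "x i \<omega> \<in> {0, 1}" if "\<omega> \<in> space M" for i \<omega>
    unfolding x_def using values_01[OF _ that] by simp
  \<comment> \<open>Since \<open>x i\<close> is at most 1, \<open>l n\<close> is at most a partial
    sum of the series \<beta>, read in reverse order, whose total is below 1.\<close>
  have l01: "0 \<le> l n \<omega>" "l n \<omega> \<le> 1" if w: "\<omega> \<in> space M" for n \<omega>
  proof -
    have x: "0 \<le> x i \<omega>" "x i \<omega> \<le> 1" for i using x01[OF w, of i] by auto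
    show "0 \<le> l n \<omega>" unfolding l_def using pos x
      by (intro add_nonneg_nonneg sum_nonneg) (auto simp: less_imp_le)
    have "l n \<omega> \<le> \<beta> 0 + (\<Sum>i<n. \<beta> (n - i))"
      unfolding l_def using pos x
      by (intro add_left_mono sum_mono) (auto simp: less_imp_le intro: mult_left_le)
    also have "(\<Sum>i<n. \<beta> (n - i)) = (\<Sum>i<n. \<beta> (Suc i))"
      using sum.nat_diff_reindex[of "\<lambda>i. \<beta> (Suc i)" n] by (simp add: Suc_diff_Suc)
    also have "\<beta> 0 + \<dots> = (\<Sum>i<Suc n. \<beta> i)" by (rule sum.lessThan_Suc_shift[symmetric])
    also have "\<dots> \<le> (\<Sum>i. \<beta> i)"
      using pos summable_beta by (intro sum_le_suminf) (auto simp: less_imp_le)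
    finally show "l n \<omega> \<le> 1" using sum_lt_1 by simp
  qed
  have d_bound: "\<bar>x i \<omega> - l i \<omega>\<bar> \<le> 1" if "\<omega> \<in> space M" for i \<omega>
    using x01[OF that, of i] l01[OF that, of i] by auto
  \<comment> \<open>The variable \<open>x i\<close> is \<open>\<xi> (Suc i)\<close>, and
    \<open>i < n\<close> puts \<open>Suc i\<close> into \<open>{1..<Suc n}\<close>, the index range
    of the generators.\<close>
  have past [measurable]: "x i \<in> borel_measurable (past_sigma M \<xi> (Suc n))" if "i < n" for i n
  proof (rule measurableI)
    fix B :: "real set" assume "B \<in> sets borel"
    then show "x i -` B \<inter> space (past_sigma M \<xi> (Suc n)) \<in> sets (past_sigma M \<xi> (Suc n))"
      unfolding x_def past_sigma_def using that
      by (auto simp: space_measure_of_conv sets_measure_of_conv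
               intro!: exI[of _ "Suc i"] exI[of _ B])
  qed simp
  \<comment> \<open>The partial sum is measurable with respect to the past, so conditioning replaces
    \<open>x n\<close> by \<open>l n\<close> under the expectation. For \<open>n = 0\<close> the sum
    is empty; \<open>n \<ge> 1\<close> corresponds to the times from 2 on, which \<open>step\<close>
    covers.\<close>
  have orth: "expectation (\<lambda>\<omega>. (\<Sum>i<n. x i \<omega> - l i \<omega>) * (x n \<omega> - l n \<omega>)) = 0" for n
  proof (cases "n = 0")
    case False
    define F where "F = past_sigma M \<xi> (Suc n)"
    interpret F: finite_measure_subalgebra M F
      by standard (simp add: F_def subalgebra_past_sigma)
    define D where "D \<omega> = (\<Sum>i<n. x i \<omega> - l i \<omega>)" for \<omega>
    define A where "A = {\<omega> \<in> space M. x n \<omega> = 1}"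
    have DF: "D \<in> borel_measurable F"
      unfolding D_def l_def F_def
      by (intro borel_measurable_sum borel_measurable_diff borel_measurable_add
                borel_measurable_times borel_measurable_const past) auto
    have [measurable]: "D \<in> borel_measurable M" "A \<in> sets M" unfolding D_def A_def by measurable
    \<comment> \<open>The variable is rewritten as an indicator because \<open>step\<close>
      conditions the indicator of an event.\<close>
    have xA: "x n \<omega> = indicator A \<omega>" if "\<omega> \<in> space M" for \<omega>
      using x01[OF that, of n] that by (auto simp: A_def)
    have D_bound: "\<bar>D \<omega>\<bar> \<le> real n" if "\<omega> \<in> space M" for \<omega>
      unfolding D_def
      using sum_norm_bound[of "{..<n}" "\<lambda>i. x i \<omega> - l i \<omega>" 1] d_bound[OF that] by simp
    have i1: "integrable M (\<lambda>\<omega>. D \<omega> * indicator A \<omega>)"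
      by (rule integrable_const_bound[of _ "real n"]) (use D_bound in \<open>auto simp: indicator_def\<close>)
    have "AE \<omega> in M. real_cond_exp M F (indicator A) \<omega> = l n \<omega>"
    proof -
      have "(\<Sum>i = 1..n. \<beta> (Suc n - i) * \<xi> i \<omega>) = (\<Sum>i<n. \<beta> (n - i) * x i \<omega>)" for \<omega>
        unfolding x_def by (simp add: sum.atLeast1_atMost_eq)
      then show ?thesis
        using step[of "Suc n"] False by (simp add: F_def A_def x_def l_def)
    qed
    then have "expectation (\<lambda>\<omega>. D \<omega> * real_cond_exp M F (indicator A) \<omega>) =
        expectation (\<lambda>\<omega>. D \<omega> * l n \<omega>)"
      by (intro integral_cong_AE) auto
    \<comment> \<open>This is the defining property of conditional expectation, tested against the
      past-measurable factor \<open>D\<close>.\<close>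
    then have eq: "expectation (\<lambda>\<omega>. D \<omega> * l n \<omega>) = expectation (\<lambda>\<omega>. D \<omega> * x n \<omega>)"
      using F.real_cond_exp_intg(2)[OF i1 DF] xA by (simp cong: Bochner_Integration.integral_cong)
    have i2: "integrable M (\<lambda>\<omega>. D \<omega> * x n \<omega>)"
      using i1 xA by (simp cong: Bochner_Integration.integrable_cong)
    have i3: "integrable M (\<lambda>\<omega>. D \<omega> * l n \<omega>)"
    proof (rule integrable_const_bound[of _ "real n"])
      show "AE \<omega> in M. norm (D \<omega> * l n \<omega>) \<le> real n"
      proof (rule AE_I2)
        fix \<omega> assume w: "\<omega> \<in> space M"
        show "norm (D \<omega> * l n \<omega>) \<le> real n"
          using mult_mono[OF D_bound[OF w] l01(2)[OF w, of n]] l01[OF w, of n] by (simp add: abs_mult)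
      qed
    qed measurable
    show ?thesis using i2 i3 eq unfolding D_def[symmetric] by (simp add: right_diff_distrib)
  qed simp
  have "AE \<omega> in M. (\<lambda>n. (\<Sum>i<n. x i \<omega> - l i \<omega>) / real n) \<longlonglongrightarrow> 0"
    by (rule strong_law_bounded_orthogonal) (use orth d_bound in auto)
  then show ?thesis
    using AE_space
  proof eventually_elim
    case (elim \<omega>)
    have "(\<lambda>n. (\<Sum>i<n. x i \<omega>) / real n) \<longlonglongrightarrow> \<beta> 0 / (1 - (\<Sum>i. \<beta> (Suc i)))"
    proof (rule average_limit_of_compensated[OF _ summable_beta])
      show "0 \<le> \<beta> i" for i using pos by (simp add: less_imp_le)
      show "(\<Sum>i. \<beta> (Suc i)) < 1"
        using suminf_split_head[OF summable_beta] sum_lt_1 pos[of 0] by simp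
      show "0 \<le> x i \<omega>" "x i \<omega> \<le> 1" for i using x01[OF elim(2), of i] by auto
    qed (use elim in \<open>simp add: l_def\<close>)
    moreover have "hawkes_count \<xi> n \<omega> = (\<Sum>i<n. x i \<omega>)" for n
      unfolding hawkes_count_def x_def by (simp add: sum.atLeast1_atMost_eq)
    ultimately show ?case by simp
  qed
qed

end
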